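(* Let $(G,\mu,\omega)$ be an infinite, connected weighted graph, and let $d$ be an intrinsic pseudo metric on it, with finite jump size $s$, which is also $1$-intrinsic with bound $C_0>0$, and such that every ball $B_r(x)$ ($x\in G$, $r>0$) is a finite set. Let $x_0\in G$, $c_0>0$, $k>s$ and $0<\alpha\le 1$, and let $V:G\to[0,\infty)$ satisfy $$V(x)\ \ge\ c_0\,[d(x,x_0)+k]^{-\alpha}\qquad\text{for all } x\in G.$$ Let $u:G\to\mathbb{R}$ be a solution of $\Delta u-Vu=0$ in $G$. Suppose that $u\in \ell^p_{\zeta_\beta}(G,\mu)$, where $\zeta_\beta(x)=[d(x,x_0)+k]^{-\beta}$, for some $\beta>0$ and $p\ge 1$ fulfilling $$p\ >\ \frac{C_0}{c_0}\,\frac{k^{\beta+1}}{(k-s)^{\beta+1}}\,\beta .$$ Then $u(x)=0$ for all $x\in G$.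
   Context: A weighted graph $(G,\mu,\omega)$ consists of a set $G$ of vertices, a node measure $\mu:G\to(0,\infty)$, and an edge weight $\omega:G\times G\to[0,\infty)$ such that $\omega(x,x)=0$ for all $x$, $\omega(x,y)=\omega(y,x)$ for all $x,y$, and $\sum_{y\in G}\omega(x,y)<\infty$ for all $x$. It is called infinite if $G$ is infinite and countable. Write $x\sim y$ if $\omega(x,y)>0$. The graph is connected if any two vertices are joined by a path, i.e. a finite sequence of vertices in which consecutive ones satisfy $\sim$. A pseudo metric is a map $d:G\times G\to[0,\infty)$ with $d(x,x)=0$, $d(x,y)=d(y,x)$ and $d(x,y)\le d(x,z)+d(y,z)$ for all $x,y,z\in G$ (possibly $d(x,y)=0$ with $x\ne y$). Its jump size is $s=\sup\{d(x,y): x,y\in G,\ \omega(x,y)>0\}$. Balls are $B_r(x_0)=\{x\in G: d(x,x_0)<r\}$. For $q\ge1$ and $C_0>0$, $d$ is $q$-intrinsic with bound $C_0$ if $\frac1{\mu(x)}\sum_{y\in G}\omega(x,y)\,d(x,y)^q\le C_0$ for all $x\in G$; $d$ is intrinsic if it is $2$-intrinsic with bound $1$. The weighted graph Laplacian is $\Delta f(x)=\frac1{\mu(x)}\sum_{y\sim x}\omega(x,y)[f(y)-f(x)]$ for $f:G\to\mathbb{R}$, $x\in G$. (Finite jump size and finiteness of balls imply that each vertex has finitely many neighbours.) A solution of $\Delta u-Vu=0$ in $G$ is a function $u:G\to\mathbb{R}$ with $\Delta u(x)-V(x)u(x)=0$ for every $x\in G$. For $\zeta:G\to(0,\infty)$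 and $p\in[1,\infty)$, $\ell^p_\zeta(G,\mu)=\{u:G\to\mathbb{R}:\ \sum_{x\in G}|u(x)|^p\zeta(x)\mu(x)<\infty\}$. *)

theory Defs
  imports "HOL-Analysis.Analysis"
begin

text \<open>
  The vertex set of a graph is a whole type \<open>'a\<close>; \<open>\<mu>\<close> is the node measure and
  \<open>\<omega>\<close> the edge weight.
\<close>

definition weighted_graph :: "('a \<Rightarrow> real) \<Rightarrow> ('a \<Rightarrow> 'a \<Rightarrow> real) \<Rightarrow> bool" where
  "weighted_graph \<mu> \<omega> \<longleftrightarrow>
     (\<forall>x. \<mu> x > 0) \<and>
     (\<forall>x y. \<omega> x y \<ge> 0) \<and>
     (\<forall>x. \<omega> x x = 0) \<and>
     (\<forall>x y. \<omega> x y = \<omega> y x) \<and>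
     (\<forall>x. (\<lambda>y. \<omega> x y) summable_on UNIV)"

definition adjacent :: "('a \<Rightarrow> 'a \<Rightarrow> real) \<Rightarrow> 'a \<Rightarrow> 'a \<Rightarrow> bool" where
  "adjacent \<omega> x y \<longleftrightarrow> \<omega> x y > 0"

definition graph_connected :: "('a \<Rightarrow> 'a \<Rightarrow> real) \<Rightarrow> bool" where
  "graph_connected \<omega> \<longleftrightarrow> (\<forall>x y. (adjacent \<omega>)\<^sup>*\<^sup>* x y)"

definition pseudo_metric :: "('a \<Rightarrow> 'a \<Rightarrow> real) \<Rightarrow> bool" where
  "pseudo_metric d \<longleftrightarrow>
     (\<forall>x y. d x y \<ge> 0) \<and>
     (\<forall>x. d x x = 0) \<and>
     (\<forall>x y. d x y = d y x) \<and>
     (\<forall>x y z. d x y \<le> d x z + d y z)"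

text \<open>
  The supremum is taken in the extended reals, so that an infinite jump size is not
  confused with a finite one. It is \<open>-\<infinity>\<close> for a graph without edges.
\<close>

definition jump_size :: "('a \<Rightarrow> 'a \<Rightarrow> real) \<Rightarrow> ('a \<Rightarrow> 'a \<Rightarrow> real) \<Rightarrow> ereal" where
  "jump_size \<omega> d = Sup {ereal (d x y) | x y. \<omega> x y > 0}"

definition pm_ball :: "('a \<Rightarrow> 'a \<Rightarrow> real) \<Rightarrow> 'a \<Rightarrow> real \<Rightarrow> 'a set" where
  "pm_ball d x0 r = {x. d x x0 < r}"

text \<open>
  Summability is required explicitly because \<open>infsum\<close> is \<open>0\<close> on families that are not
  summable, whereas a bound on a series of nonnegative terms includes its convergence.
\<close>

definition q_intrinsic ::
  "real \<Rightarrow> real \<Rightarrow> ('a \<Rightarrow> real) \<Rightarrow> ('a \<Rightarrow> 'a \<Rightarrow> real) \<Rightarrow> ('a \<Rightarrow> 'a \<Rightarrow> real) \<Rightarrow> bool" where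
  "q_intrinsic q C \<mu> \<omega> d \<longleftrightarrow>
     (\<forall>x. (\<lambda>y. \<omega> x y * d x y powr q) summable_on UNIV \<and>
          1 / \<mu> x * (\<Sum>\<^sub>\<infinity>y. \<omega> x y * d x y powr q) \<le> C)"

definition intrinsic ::
  "('a \<Rightarrow> real) \<Rightarrow> ('a \<Rightarrow> 'a \<Rightarrow> real) \<Rightarrow> ('a \<Rightarrow> 'a \<Rightarrow> real) \<Rightarrow> bool" where
  "intrinsic \<mu> \<omega> d \<longleftrightarrow> q_intrinsic 2 1 \<mu> \<omega> d"

text \<open>For graphs in which every vertex has finitely many neighbours this is a finite sum.\<close>

definition laplacian ::
  "('a \<Rightarrow> real) \<Rightarrow> ('a \<Rightarrow> 'a \<Rightarrow> real) \<Rightarrow> ('a \<Rightarrow> real) \<Rightarrow> 'a \<Rightarrow> real" where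
  "laplacian \<mu> \<omega> f x = 1 / \<mu> x * (\<Sum>\<^sub>\<infinity>y\<in>{y. adjacent \<omega> x y}. \<omega> x y * (f y - f x))"

definition schroedinger_solution ::
  "('a \<Rightarrow> real) \<Rightarrow> ('a \<Rightarrow> 'a \<Rightarrow> real) \<Rightarrow> ('a \<Rightarrow> real) \<Rightarrow> ('a \<Rightarrow> real) \<Rightarrow> bool" where
  "schroedinger_solution \<mu> \<omega> V u \<longleftrightarrow> (\<forall>x. laplacian \<mu> \<omega> u x - V x * u x = 0)"

definition weighted_lp :: "real \<Rightarrow> ('a \<Rightarrow> real) \<Rightarrow> ('a \<Rightarrow> real) \<Rightarrow> ('a \<Rightarrow> real) set" where
  "weighted_lp p \<zeta> \<mu> = {u. (\<lambda>x. \<bar>u x\<bar> powr p * \<zeta> x * \<mu> x) summable_on UNIV}"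

end

theory Submission
  imports Defs
begin

text \<open>
  By convexity \<open>v = \<bar>u\<bar>\<^sup>p\<close> satisfies \<open>\<Delta>v \<ge> p V v\<close>. Test this against \<open>\<phi> = \<zeta> \<eta>\<close>, where
  \<open>\<zeta> = (d(\<cdot>,x0) + k)\<^sup>-\<^sup>\<beta>\<close> and \<open>\<eta> = max 0 (1 - d(\<cdot>,x0)/R)\<close>, and move the Laplacian to \<open>\<phi>\<close>.
  The bound on the first moment of the jumps gives
  \<open>\<Delta>\<phi> \<le> C0 \<beta> (k/(k-s))\<^sup>\<beta>\<^sup>+\<^sup>1 (d(\<cdot>,x0) + k)\<^sup>-\<^sup>\<beta>\<^sup>-\<^sup>1 \<eta> + O(\<zeta>/R)\<close>.
  The hypothesis on \<open>p\<close> ensures that \<open>p V \<zeta>\<close> dominates the first term,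
  and the second one, summed against \<open>v\<close>, vanishes as \<open>R \<rightarrow> \<infinity>\<close> because \<open>u\<close> is in the weighted space.
\<close>

section \<open>Convexity of powers: tangent-line inequalities\<close>

lemma powr_above_tangent:
  fixes a t q :: real
  assumes "0 < a" "0 < t" and q: "q \<le> 0 \<or> 1 \<le> q"
  shows "a powr q + q * a powr (q - 1) * (t - a) \<le> t powr q"
proof -
  have "convex_on {0<..} (\<lambda>x. x powr q)"
  proof (rule f''_ge0_imp_convex[where f' = "\<lambda>x. q * x powr (q - 1)"
        and f'' = "\<lambda>x. q * ((q - 1) * x powr (q - 2))"])
    show "0 \<le> q * ((q - 1) * x powr (q - 2))" for x
      using q
    proof
      assume "q \<le> 0"
      then show ?thesis by (intro mult_nonpos_nonpos mult_nonpos_nonneg) auto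
    next
      assume "1 \<le> q"
      then show ?thesis by (intro mult_nonneg_nonneg) auto
    qed
  qed (auto intro!: derivative_eq_intros)
  moreover have "((\<lambda>x. x powr q) has_real_derivative q * a powr (q - 1)) (at a within {0<..})"
    using \<open>0 < a\<close> by (auto intro!: derivative_eq_intros)
  ultimately have "q * a powr (q - 1) * (t - a) \<le> t powr q - a powr q"
    using assms by (intro convex_on_imp_above_tangent[where A = "{0<..}"]) (auto simp: interior_open)
  then show ?thesis by simp
qed

text \<open>The slope is the derivative of \<open>\<bar>t\<bar> powr p\<close> at \<open>a\<close>;
  at \<open>a = 0\<close> it is read as \<open>0\<close> through \<open>sgn 0 = 0\<close>, which is
  still a subgradient when \<open>p = 1\<close>. Since
  \<open>sgn a * (b - a) \<le> \<bar>b\<bar> - \<bar>a\<bar>\<close>, the claim reduces to the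
  half-line.\<close>

lemma abs_powr_above_tangent:
  fixes a b p :: real
  assumes p: "1 \<le> p"
  shows "p * \<bar>a\<bar> powr (p - 1) * sgn a * (b - a) \<le> \<bar>b\<bar> powr p - \<bar>a\<bar> powr p"
proof (cases "a = 0")
  case False
  have pa: "\<bar>a\<bar> powr p = \<bar>a\<bar> powr (p - 1) * \<bar>a\<bar>"
    using False by (simp add: powr_diff)
  have "sgn a * (b - a) \<le> \<bar>b\<bar> - \<bar>a\<bar>"
    by (auto simp: sgn_if)
  then have "p * \<bar>a\<bar> powr (p - 1) * (sgn a * (b - a)) \<le> p * \<bar>a\<bar> powr (p - 1) * (\<bar>b\<bar> - \<bar>a\<bar>)"
    using p by (intro mult_left_mono) auto
  also have "\<dots> \<le> \<bar>b\<bar> powr p - \<bar>a\<bar> powr p"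
  proof (cases "b = 0")
    case True
    have "1 * \<bar>a\<bar> powr p \<le> p * \<bar>a\<bar> powr p" using p by (intro mult_right_mono) auto
    then show ?thesis using True by (simp add: pa)
  next
    case bnz: False
    show ?thesis using powr_above_tangent[of "\<bar>a\<bar>" "\<bar>b\<bar>" p] p False bnz by simp
  qed
  finally show ?thesis by (simp add: mult.assoc)
qed auto

text \<open>The tangent is taken at \<open>b\<close>, so the slope is controlled by a lower bound
  for \<open>b\<close> alone; \<open>a\<close> and \<open>b\<close> may come in either
  order.\<close>

lemma powr_neg_diff_le:
  fixes a b m \<beta> :: real
  assumes "0 < m" "m \<le> b" "0 < a" "0 \<le> \<beta>"
  shows "b powr (-\<beta>) - a powr (-\<beta>) \<le> \<beta> * m powr (-\<beta> - 1) * \<bar>b - a\<bar>"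
proof -
  have "b powr (-\<beta>) - a powr (-\<beta>) \<le> \<beta> * b powr (-\<beta> - 1) * (a - b)"
    using powr_above_tangent[of b a "-\<beta>"] assms by simp
  also have "\<dots> \<le> \<beta> * b powr (-\<beta> - 1) * \<bar>b - a\<bar>"
    using assms by (intro mult_left_mono) auto
  also have "\<dots> \<le> \<beta> * m powr (-\<beta> - 1) * \<bar>b - a\<bar>"
    using assms by (intro mult_right_mono mult_left_mono powr_mono2') auto
  finally show ?thesis .
qed

section \<open>Summation by parts and the subsolution property of
  \<open>\<bar>u\<bar> powr p\<close>\<close>

text \<open>Both sums run over the same finite set, so symmetry of \<open>w\<close> suffices and no
  boundary term arises.\<close>

lemma green_formula_finite:
  fixes f g :: "'a \<Rightarrow> real"
  assumes "\<And>x y. w x y = w y x"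
  shows "(\<Sum>x\<in>A. f x * (\<Sum>y\<in>A. w x y * (g y - g x)))
       = (\<Sum>x\<in>A. g x * (\<Sum>y\<in>A. w x y * (f y - f x)))"
proof -
  have "(\<Sum>x\<in>A. \<Sum>y\<in>A. w x y * f x * g y) = (\<Sum>x\<in>A. \<Sum>y\<in>A. w x y * f y * g x)"
    by (subst sum.swap) (simp add: assms)
  then show ?thesis
    by (simp add: sum_distrib_left sum_subtractf algebra_simps)
qed

lemma laplacian_eq_sum:
  assumes "weighted_graph \<mu> \<omega>" "finite A" "{y. adjacent \<omega> x y} \<subseteq> A"
  shows "\<mu> x * laplacian \<mu> \<omega> f x = (\<Sum>y\<in>A. \<omega> x y * (f y - f x))"
proof -
  have mu: "\<mu> x \<noteq> 0"
    and nonadj: "\<not> adjacent \<omega> x y \<Longrightarrow> \<omega> x y = 0" for y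
    using assms(1) by (auto simp: weighted_graph_def adjacent_def less_le)
  have "finite {y. adjacent \<omega> x y}"
    using assms(2,3) finite_subset by blast
  then have "(\<Sum>\<^sub>\<infinity>y\<in>{y. adjacent \<omega> x y}. \<omega> x y * (f y - f x))
      = (\<Sum>y\<in>{y. adjacent \<omega> x y}. \<omega> x y * (f y - f x))"
    by simp
  also have "\<dots> = (\<Sum>y\<in>A. \<omega> x y * (f y - f x))"
    using assms(2,3) nonadj by (intro sum.mono_neutral_left) auto
  finally show ?thesis using mu by (simp add: laplacian_def)
qed

text \<open>Multiply the equation at \<open>x\<close> by the slope \<open>g\<close> of
  \<open>\<bar>t\<bar> powr p\<close> at \<open>u x\<close>, and apply the tangent inequality edge
  by edge; the weights are nonnegative.\<close>

lemma abs_powr_subsolution: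
  assumes "weighted_graph \<mu> \<omega>" "schroedinger_solution \<mu> \<omega> V u" "1 \<le> p"
    and "finite A" "{y. adjacent \<omega> x y} \<subseteq> A"
  shows "p * V x * \<bar>u x\<bar> powr p * \<mu> x \<le> (\<Sum>y\<in>A. \<omega> x y * (\<bar>u y\<bar> powr p - \<bar>u x\<bar> powr p))"
proof -
  define g where "g = p * \<bar>u x\<bar> powr (p - 1) * sgn (u x)"
  have "g * u x = p * \<bar>u x\<bar> powr p"
    by (cases "u x = 0") (auto simp: g_def powr_diff sgn_if)
  moreover have "\<mu> x * (V x * u x) = (\<Sum>y\<in>A. \<omega> x y * (u y - u x))"
    using assms(2) laplacian_eq_sum[OF assms(1,4,5), of u]
    by (simp add: schroedinger_solution_def)
  ultimately have "p * V x * \<bar>u x\<bar> powr p * \<mu> x = g * (\<Sum>y\<in>A. \<omega> x y * (u y - u x))"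
    by (metis (no_types, lifting) mult.assoc mult.commute)
  also have "\<dots> = (\<Sum>y\<in>A. \<omega> x y * (g * (u y - u x)))"
    by (simp add: sum_distrib_left mult.left_commute)
  also have "\<dots> \<le> (\<Sum>y\<in>A. \<omega> x y * (\<bar>u y\<bar> powr p - \<bar>u x\<bar> powr p))"
    using assms(1) abs_powr_above_tangent[OF assms(3)]
    by (intro sum_mono mult_left_mono) (auto simp: g_def weighted_graph_def)
  finally show ?thesis .
qed

lemma one_intrinsic_sum_le:
  assumes "weighted_graph \<mu> \<omega>" "pseudo_metric d" "q_intrinsic 1 C \<mu> \<omega> d" "finite A"
  shows "(\<Sum>y\<in>A. \<omega> x y * d x y) \<le> C * \<mu> x"
proof -
  have "d x y powr 1 = d x y" for y
    using assms(2) by (simp add: pseudo_metric_def)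
  then have "(\<lambda>y. \<omega> x y * d x y) summable_on UNIV" "1 / \<mu> x * (\<Sum>\<^sub>\<infinity>y. \<omega> x y * d x y) \<le> C"
    using assms(3) unfolding q_intrinsic_def by (metis (no_types, lifting) ext)+
  moreover from this(1) have "(\<Sum>y\<in>A. \<omega> x y * d x y) \<le> (\<Sum>\<^sub>\<infinity>y. \<omega> x y * d x y)"
    using assms by (intro finite_sum_le_infsum) (auto simp: weighted_graph_def pseudo_metric_def)
  moreover have "\<mu> x > 0" using assms(1) by (simp add: weighted_graph_def)
  ultimately show ?thesis by (simp add: field_simps)
qed

section \<open>Cutoff, test function and the tested inequality\<close>

definition cutoff :: "real \<Rightarrow> real \<Rightarrow> real" where
  "cutoff R r = max 0 (1 - r / R)"

lemma cutoff_nonneg: "0 \<le> cutoff R r"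
  by (simp add: cutoff_def)

lemma cutoff_diff_le:
  assumes "0 < R"
  shows "cutoff R t - cutoff R r \<le> \<bar>t - r\<bar> / R"
proof -
  have "cutoff R t - cutoff R r \<le> \<bar>t / R - r / R\<bar>"
    by (auto simp: cutoff_def)
  also have "\<dots> = \<bar>t - r\<bar> / R"
    using assms by (simp flip: diff_divide_distrib)
  finally show ?thesis .
qed

text \<open>Discrete product rule: the difference of the weights is multiplied by the cutoff at
  \<open>r\<close>, and the difference of the cutoffs by the weight at \<open>t\<close>. Keeping
  \<open>cutoff R r\<close> in the first term is what allows it to be absorbed later.\<close>

lemma weight_cutoff_diff_le:
  fixes r t \<delta> s K \<beta> R :: real
  assumes "0 \<le> r" "0 \<le> t" "\<bar>t - r\<bar> \<le> \<delta>" "\<delta> \<le> s" "0 \<le> s" "s < K" "0 < R" "0 < \<beta>"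
  shows "(t + K) powr (-\<beta>) * cutoff R t - (r + K) powr (-\<beta>) * cutoff R r
    \<le> (\<beta> * (K / (K - s)) powr (\<beta> + 1) * (r + K) powr (-\<beta> - 1) * cutoff R r
        + (K / (K - s)) powr \<beta> * (r + K) powr (-\<beta>) / R) * \<delta>"
proof -
  \<comment> \<open>A lower bound for \<open>t + K\<close> proportional to \<open>r + K\<close>: a
    jump lowers \<open>r + K\<close> by at most \<open>s\<close>, and
    \<open>s \<le> s * (r + K) / K\<close>. Powers of \<open>m\<close> are then constants times
    powers of \<open>r + K\<close>.\<close>
  define m where "m = (r + K) / (K / (K - s))"
  have m0: "0 < m" using assms by (simp add: m_def)
  have "(r + K) * (K - s) \<le> (r + K - s) * K"
    using assms by (simp add: algebra_simps)
  then have "m \<le> r + K - s"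
    using assms by (simp add: m_def pos_divide_le_eq)
  then have mt: "m \<le> t + K"
    using assms by linarith
  have m_powr: "m powr (- q) = (K / (K - s)) powr q * (r + K) powr (- q)" for q
    using assms unfolding m_def by (subst powr_divide) (auto simp: powr_minus divide_simps)
  have "(t + K) powr (-\<beta>) - (r + K) powr (-\<beta>) \<le> \<beta> * m powr (-\<beta> - 1) * \<bar>(t + K) - (r + K)\<bar>"
    using assms m0 mt by (intro powr_neg_diff_le) auto
  also have "\<dots> \<le> \<beta> * m powr (-\<beta> - 1) * \<delta>"
    using assms by (intro mult_left_mono) auto
  finally have 1: "((t + K) powr (-\<beta>) - (r + K) powr (-\<beta>)) * cutoff R r
      \<le> \<beta> * m powr (-\<beta> - 1) * \<delta> * cutoff R r"
    by (intro mult_right_mono cutoff_nonneg)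
  have "cutoff R t - cutoff R r \<le> \<delta> / R"
    using cutoff_diff_le[of R t r] assms by (smt (verit) divide_right_mono)
  then have "(t + K) powr (-\<beta>) * (cutoff R t - cutoff R r) \<le> (t + K) powr (-\<beta>) * (\<delta> / R)"
    by (intro mult_left_mono) auto
  also have "\<dots> \<le> m powr (-\<beta>) * (\<delta> / R)"
    using assms m0 mt by (intro mult_right_mono powr_mono2') auto
  finally have 2: "(t + K) powr (-\<beta>) * (cutoff R t - cutoff R r) \<le> m powr (-\<beta>) * (\<delta> / R)" .
  have m_powr_Suc: "m powr (-\<beta> - 1) = (K / (K - s)) powr (\<beta> + 1) * (r + K) powr (-\<beta> - 1)"
    using m_powr[of "\<beta> + 1"] by simp
  show ?thesis
    using 1 2 unfolding m_powr m_powr_Suc by (simp add: algebra_simps)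
qed

text \<open>\<open>\<delta>\<close> is what remains of the potential term \<open>p * c\<close> after
  absorbing the main part of the Laplacian of the test function. Only the slope of the cutoff is
  left on the right, hence the factor \<open>1 / R\<close>.\<close>

lemma cutoff_estimate:
  fixes \<mu> :: "'a \<Rightarrow> real"
  assumes graph: "weighted_graph \<mu> \<omega>" and metric: "pseudo_metric d"
    and jump: "\<And>x y. \<omega> x y > 0 \<Longrightarrow> d x y \<le> s" and "0 \<le> s" "s < K"
    and intr: "q_intrinsic 1 C \<mu> \<omega> d" and "0 \<le> C"
    and fin: "\<And>r. r > 0 \<Longrightarrow> finite (pm_ball d x0 r)"
    and V: "\<And>x. V x \<ge> c / (d x x0 + K)"
    and sol: "schroedinger_solution \<mu> \<omega> V u"
    and "0 < \<beta>" "1 \<le> p" "0 < R"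
    and gap: "\<delta> = p * c - C * \<beta> * (K / (K - s)) powr (\<beta> + 1)" "0 < \<delta>"
    and summ: "(\<lambda>x. \<bar>u x\<bar> powr p * (d x x0 + K) powr (-\<beta>) * \<mu> x) summable_on UNIV"
  shows "\<delta> * cutoff R (d x x0) * (\<bar>u x\<bar> powr p * (d x x0 + K) powr (-\<beta> - 1) * \<mu> x)
    \<le> C * (K / (K - s)) powr \<beta> / R
       * (\<Sum>\<^sub>\<infinity>x. \<bar>u x\<bar> powr p * (d x x0 + K) powr (-\<beta>) * \<mu> x)"
proof -
  define L M where "L = (K / (K - s)) powr (\<beta> + 1)" and "M = (K / (K - s)) powr \<beta>"
  define r where "r x = d x x0" for x
  define v where "v x = \<bar>u x\<bar> powr p" for x
  define \<eta> where "\<eta> x = cutoff R (r x)" for x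
  define \<phi> where "\<phi> x = (r x + K) powr (-\<beta>) * \<eta> x" for x
  \<comment> \<open>The extra \<open>s\<close> puts all neighbours of the support of
    \<open>\<eta>\<close> into \<open>A\<close>.\<close>
  define A where "A = pm_ball d x0 (R + s)"
  have d: "d x y \<ge> 0" "d x y = d y x" "d x z \<le> d x y + d y z" for x y z
    using metric unfolding pseudo_metric_def by metis+
  have mu: "\<mu> x > 0" and w: "\<omega> x y \<ge> 0" "\<omega> x y = \<omega> y x" for x y
    using graph by (auto simp: weighted_graph_def)
  have r0: "r x \<ge> 0" and v0: "v x \<ge> 0" and \<eta>0: "\<eta> x \<ge> 0" and \<phi>0: "\<phi> x \<ge> 0" for x
    by (simp_all add: r_def d v_def \<eta>_def \<phi>_def cutoff_nonneg)
  have rd: "\<bar>r y - r x\<bar> \<le> d x y" for x y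
    using d(3)[of y x0 x] d(3)[of x x0 y] d(2)[of x y] by (auto simp: r_def)
  have K0: "0 < K" using assms by linarith
  have finA: "finite A"
    unfolding A_def using assms by (intro fin) auto
  have A: "x \<in> A" "{y. adjacent \<omega> x y} \<subseteq> A" if "\<eta> x > 0" for x
  proof -
    have "r x < R" using that \<open>0 < R\<close> by (auto simp: \<eta>_def cutoff_def max_def divide_simps split: if_splits)
    then show "x \<in> A" using \<open>0 \<le> s\<close> by (simp add: A_def pm_ball_def r_def)
    show "{y. adjacent \<omega> x y} \<subseteq> A"
    proof
      fix y assume "y \<in> {y. adjacent \<omega> x y}"
      then have "d x y \<le> s" using jump by (simp add: adjacent_def)
      then show "y \<in> A"
        using rd[of y x] \<open>r x < R\<close> unfolding A_def pm_ball_def r_def by simp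
    qed
  qed
  \<comment> \<open>Where \<open>A\<close> may miss neighbours of \<open>x\<close>,
    \<open>\<phi> x = 0\<close> and both sides vanish.\<close>
  have low: "\<phi> x * (p * V x * v x * \<mu> x) \<le> \<phi> x * (\<Sum>y\<in>A. \<omega> x y * (v y - v x))" for x
  proof (cases "\<eta> x > 0")
    case True
    then show ?thesis
      unfolding v_def
      by (intro mult_left_mono abs_powr_subsolution[OF graph sol \<open>1 \<le> p\<close> finA A(2)] \<phi>0)
  next
    case False
    then show ?thesis using \<eta>0[of x] by (simp add: \<phi>_def)
  qed
  \<comment> \<open>This holds even if \<open>A\<close> misses neighbours: each term is bounded by a
    nonnegative multiple of \<open>\<omega> x y * d x y\<close>, and the moment bound covers every
    finite partial sum.\<close>
  have up: "(\<Sum>y\<in>A. \<omega> x y * (\<phi> y - \<phi> x))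
      \<le> (\<beta> * L * (r x + K) powr (-\<beta> - 1) * \<eta> x + M * (r x + K) powr (-\<beta>) / R) * (C * \<mu> x)"
    (is "_ \<le> ?b * _") for x
  proof -
    have "(\<Sum>y\<in>A. \<omega> x y * (\<phi> y - \<phi> x)) \<le> (\<Sum>y\<in>A. \<omega> x y * (?b * d x y))"
    proof (intro sum_mono)
      fix y
      show "\<omega> x y * (\<phi> y - \<phi> x) \<le> \<omega> x y * (?b * d x y)"
      proof (cases "\<omega> x y > 0")
        case True
        then show ?thesis
          unfolding \<phi>_def \<eta>_def L_def M_def
          using assms jump[OF True] rd[of y x] r0
          by (intro mult_left_mono weight_cutoff_diff_le) auto
      next
        case False
        then show ?thesis using w(1)[of x y] by simp
      qed
    qed
    also have "\<dots> = ?b * (\<Sum>y\<in>A. \<omega> x y * d x y)"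
      by (simp add: sum_distrib_left mult.left_commute)
    also have "\<dots> \<le> ?b * (C * \<mu> x)"
    proof (intro mult_left_mono one_intrinsic_sum_le[OF graph metric intr finA])
      show "0 \<le> ?b"
        using \<eta>0[of x] \<open>0 < \<beta>\<close> \<open>0 < R\<close> by (simp add: L_def M_def)
    qed
    finally show ?thesis .
  qed
  define e where "e x = v x * (r x + K) powr (-\<beta> - 1) * \<mu> x" for x
  define f where "f x = v x * (r x + K) powr (-\<beta>) * \<mu> x" for x
  have e0: "0 \<le> e x" and f0: "0 \<le> f x" for x
    using v0 mu[of x] by (auto simp: e_def f_def)
  \<comment> \<open>The decay of the lower bound on \<open>V\<close> turns the exponent
    \<open>-\<beta>\<close> into \<open>-\<beta> - 1\<close>, the one produced by differentiating
    the weight, so the two sides become comparable.\<close>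
  have "(\<Sum>x\<in>A. p * c * (\<eta> x * e x)) \<le> (\<Sum>x\<in>A. \<phi> x * (p * V x * v x * \<mu> x))"
  proof (intro sum_mono)
    fix x
    have "(r x + K) powr (-\<beta> - 1) * c = (r x + K) powr (-\<beta>) * (c / (r x + K))"
      using r0[of x] K0 by (simp add: powr_diff)
    also have "\<dots> \<le> (r x + K) powr (-\<beta>) * V x"
      using V[of x] by (intro mult_left_mono) (auto simp: r_def)
    finally have "(p * \<eta> x * v x * \<mu> x) * ((r x + K) powr (-\<beta> - 1) * c)
        \<le> (p * \<eta> x * v x * \<mu> x) * ((r x + K) powr (-\<beta>) * V x)"
      using \<eta>0 v0 mu[of x] \<open>1 \<le> p\<close> by (intro mult_left_mono) auto
    then show "p * c * (\<eta> x * e x) \<le> \<phi> x * (p * V x * v x * \<mu> x)"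
      by (simp add: e_def \<phi>_def mult_ac)
  qed
  also have "\<dots> \<le> (\<Sum>x\<in>A. \<phi> x * (\<Sum>y\<in>A. \<omega> x y * (v y - v x)))"
    by (intro sum_mono low)
  also have "\<dots> = (\<Sum>x\<in>A. v x * (\<Sum>y\<in>A. \<omega> x y * (\<phi> y - \<phi> x)))"
    by (intro green_formula_finite w)
  also have "\<dots> \<le> (\<Sum>x\<in>A. v x * ((\<beta> * L * (r x + K) powr (-\<beta> - 1) * \<eta> x
      + M * (r x + K) powr (-\<beta>) / R) * (C * \<mu> x)))"
    by (intro sum_mono mult_left_mono up v0)
  also have "\<dots> = (\<Sum>x\<in>A. C * \<beta> * L * (\<eta> x * e x) + C * M / R * f x)"
    by (intro sum.cong) (auto simp: e_def f_def algebra_simps)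
  also have "\<dots> = C * \<beta> * L * (\<Sum>x\<in>A. \<eta> x * e x) + C * M / R * (\<Sum>x\<in>A. f x)"
    by (simp only: sum.distrib sum_distrib_left)
  \<comment> \<open>The same finite sum of \<open>\<eta> x * e x\<close> occurs on both sides and is
    subtracted.\<close>
  finally have "\<delta> * (\<Sum>x\<in>A. \<eta> x * e x) \<le> C * M / R * (\<Sum>x\<in>A. f x)"
    by (simp add: gap L_def sum_distrib_left[symmetric] left_diff_distrib)
  also have "\<dots> \<le> C * M / R * (\<Sum>\<^sub>\<infinity>x. f x)"
    using summ finA f0 \<open>0 \<le> C\<close> \<open>0 < R\<close>
    by (intro mult_left_mono finite_sum_le_infsum) (auto simp: f_def v_def r_def M_def)
  finally have main: "\<delta> * (\<Sum>x\<in>A. \<eta> x * e x) \<le> C * M / R * (\<Sum>\<^sub>\<infinity>x. f x)" .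
  have "\<eta> x * e x \<le> (\<Sum>x\<in>A. \<eta> x * e x)"
  proof (cases "\<eta> x > 0")
    case True
    then show ?thesis
      using A(1) finA \<eta>0 e0 by (intro member_le_sum) auto
  next
    case False
    then have "\<eta> x = 0" using \<eta>0[of x] by simp
    then show ?thesis
      using \<eta>0 e0 by (simp add: sum_nonneg)
  qed
  then have "\<delta> * (\<eta> x * e x) \<le> \<delta> * (\<Sum>x\<in>A. \<eta> x * e x)"
    using gap(2) by (intro mult_left_mono) auto
  also note main
  finally show ?thesis
    by (simp add: \<eta>_def e_def f_def v_def r_def M_def mult.assoc)
qed

section \<open>Reduction to the tested inequality and the limit of large \<open>R\<close>\<close>

theorem theorem3p4:
  fixes \<mu> :: "'a \<Rightarrow> real"
    and \<omega> d :: "'a \<Rightarrow> 'a \<Rightarrow> real"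
    and V u :: "'a \<Rightarrow> real"
    and x0 :: 'a
    and s C0 c0 k \<alpha> \<beta> p :: real
  assumes "weighted_graph \<mu> \<omega>"
    and "infinite (UNIV :: 'a set)"
    and "countable (UNIV :: 'a set)"
    and "graph_connected \<omega>"
    and "pseudo_metric d"
    and "intrinsic \<mu> \<omega> d"
    and "jump_size \<omega> d = ereal s"
    and "C0 > 0"
    and "q_intrinsic 1 C0 \<mu> \<omega> d"
    and "\<And>x r. r > 0 \<Longrightarrow> finite (pm_ball d x r)"
    and "c0 > 0"
    and "k > s"
    and "0 < \<alpha>" and "\<alpha> \<le> 1"
    and "\<And>x. V x \<ge> 0"
    and "\<And>x. V x \<ge> c0 * (d x x0 + k) powr (-\<alpha>)"
    and "schroedinger_solution \<mu> \<omega> V u"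
    and "\<beta> > 0" and "p \<ge> 1"
    and "u \<in> weighted_lp p (\<lambda>x. (d x x0 + k) powr (-\<beta>)) \<mu>"
    and "p > C0 / c0 * (k powr (\<beta> + 1) / (k - s) powr (\<beta> + 1)) * \<beta>"
  shows "\<forall>x. u x = 0"
proof (rule allI, rule ccontr)
  fix x assume ux: "u x \<noteq> 0"
  have d0: "d y z \<ge> 0" for y z using assms(5) by (simp add: pseudo_metric_def)
  have mu: "\<mu> y > 0" for y using assms(1) by (simp add: weighted_graph_def)
  have jump: "d y z \<le> s" if "\<omega> y z > 0" for y z
  proof -
    have "ereal (d y z) \<le> jump_size \<omega> d"
      unfolding jump_size_def using that by (intro Sup_upper) auto
    then show ?thesis using assms(7) by simp
  qed
  \<comment> \<open>A real jump size excludes the edgeless graph, whose supremum is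
    \<open>-\<infinity>\<close>; any edge then gives \<open>0 \<le> s\<close>.\<close>
  have "\<exists>y z. \<omega> y z > 0"
  proof (rule ccontr)
    assume "\<not> (\<exists>y z. \<omega> y z > 0)"
    then have "jump_size \<omega> d = -\<infinity>" by (simp add: jump_size_def bot_ereal_def)
    then show False using assms(7) by simp
  qed
  then have s0: "0 \<le> s" using jump d0 order_trans by blast
  \<comment> \<open>Raising \<open>k\<close> only weakens the assumptions, and \<open>k \<ge> 1\<close> lets the exponent \<open>\<alpha>\<close> be replaced by \<open>1\<close>.\<close>
  define K where "K = max k 1"
  have K: "k \<le> K" "1 \<le> K" "s < K" "0 < k" using assms(12) s0 by (auto simp: K_def)
  \<comment> \<open>\<open>t / (t - s)\<close> does not increase in \<open>t > s\<close> because
    \<open>s \<ge> 0\<close>, so the lower bound on \<open>p\<close> survives the change to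
    \<open>K\<close>.\<close>
  have ratio: "K / (K - s) \<le> k / (k - s)"
  proof -
    have "K * (k - s) \<le> k * (K - s)" using mult_right_mono[OF K(1) s0] by (simp add: algebra_simps)
    then show ?thesis using K assms(12) by (simp add: divide_simps)
  qed
  have VK: "V y \<ge> c0 / (d y x0 + K)" for y
  proof -
    have "c0 / (d y x0 + K) = c0 * (d y x0 + K) powr (-1)"
      using d0[of y x0] K by (simp add: powr_minus divide_inverse)
    also have "\<dots> \<le> c0 * (d y x0 + K) powr (-\<alpha>)"
      using d0[of y x0] K assms(11,14) by (intro mult_left_mono powr_mono) auto
    also have "\<dots> \<le> c0 * (d y x0 + k) powr (-\<alpha>)"
      using d0[of y x0] K assms(11,13) by (intro mult_left_mono powr_mono2') auto
    finally show ?thesis using assms(16)[of y] by linarith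
  qed
  define \<delta> where "\<delta> = p * c0 - C0 * \<beta> * (K / (K - s)) powr (\<beta> + 1)"
  have "C0 * \<beta> * (K / (K - s)) powr (\<beta> + 1) \<le> C0 * \<beta> * (k / (k - s)) powr (\<beta> + 1)"
    using assms(8,18) ratio K by (intro mult_left_mono powr_mono2) auto
  also have "\<dots> = C0 / c0 * (k powr (\<beta> + 1) / (k - s) powr (\<beta> + 1)) * \<beta> * c0"
    using assms(11,12) K by (simp add: powr_divide)
  also have "\<dots> < p * c0"
    using assms(11,21) by (intro mult_strict_right_mono)
  finally have \<delta>: "0 < \<delta>" by (simp add: \<delta>_def)
  define g where "g y = \<bar>u y\<bar> powr p * (d y x0 + K) powr (-\<beta>) * \<mu> y" for y
  have summ: "g summable_on UNIV"
  proof (rule summable_on_comparison_test)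
    show "(\<lambda>y. \<bar>u y\<bar> powr p * (d y x0 + k) powr (-\<beta>) * \<mu> y) summable_on UNIV"
      using assms(20) by (simp add: weighted_lp_def)
    show "g y \<le> \<bar>u y\<bar> powr p * (d y x0 + k) powr (-\<beta>) * \<mu> y" for y
      unfolding g_def using d0[of y x0] K mu[of y] assms(18)
      by (intro mult_right_mono mult_left_mono powr_mono2') auto
    show "0 \<le> g y" for y using mu[of y] by (simp add: g_def)
  qed
  \<comment> \<open>\<open>a\<close> and \<open>b\<close> do not depend on \<open>R\<close>, and
    \<open>a > 0\<close> because \<open>u x \<noteq> 0\<close>.\<close>
  define a where "a = \<delta> * (\<bar>u x\<bar> powr p * (d x x0 + K) powr (-\<beta> - 1) * \<mu> x)"
  define b where "b = C0 * (K / (K - s)) powr \<beta> * infsum g UNIV"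
  have a0: "0 < a" using \<delta> ux mu[of x] d0[of x x0] K by (simp add: a_def)
  have est: "a * cutoff R (d x x0) \<le> b / R" if "0 < R" for R
    using cutoff_estimate[OF assms(1,5) jump s0 K(3) assms(9) _ assms(10) VK assms(17,18,19) that \<delta>_def \<delta>
        summ[unfolded g_def], of x] assms(8)
    by (simp add: a_def b_def g_def[abs_def] mult_ac)
  have "a * R \<le> a * d x x0 + b" if "0 < R" for R
  proof -
    have "a * (1 - d x x0 / R) \<le> a * cutoff R (d x x0)"
      using a0 by (intro mult_left_mono) (auto simp: cutoff_def)
    also note est[OF that]
    finally have "R * (a * (1 - d x x0 / R)) \<le> R * (b / R)"
      using that by (intro mult_left_mono) auto
    then show ?thesis using that by (simp add: algebra_simps)
  qed
  \<comment> \<open>For this positive \<open>R\<close>, \<open>a * R\<close> exceeds the bound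
    \<open>a * d x x0 + b\<close> by at least \<open>1\<close>.\<close>
  from this[of "(\<bar>a * d x x0 + b\<bar> + 1) / a"] a0 show False
    by simp
qed

end
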